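(* Let $I\subseteq(0,\infty)$ be an open interval, let $f:I\to\mathbb{R}$ be smooth, and let $M$ be a surface of revolution in the semi-isotropic space $\mathbb{SI}^3$, i.e. a surface parameterized on $I\times\mathbb{R}$ by $$r(u,v)=(u\sinh v,\;u\cosh v,\;f(u))\quad\text{or}\quad r(u,v)=(u\cosh v,\;u\sinh v,\;f(u)).$$ Assume that $M$ has no parabolic points, i.e. $f'(u)f''(u)\neq0$ for all $u\in I$. Write $r=(r_1,r_2,r_3)$ and let $\bigtriangleup^{II}$ be the Laplace operator with respect to the second fundamental form. Then there exist $\lambda_1,\lambda_2,\lambda_3\in\mathbb{R}$ such that $\bigtriangleup^{II}r_i=\lambda_ir_i$ for $i=1,2,3$ if and only if $M$ is (s-i)-minimal, i.e. its semi-isotropic mean curvature $H$ vanishes identically.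
   Context: The semi-isotropic space $\mathbb{SI}^3$ is $\mathbb{R}^3$ with the scalar product $\langle a,b\rangle=a_1b_1-a_2b_2$ (for vectors that are not both of the form $(0,0,* )$; in that exceptional case $\langle a,b\rangle=a_3b_3$). For a parameterized surface $r(u,v)$ whose tangent planes contain no vector parallel to the $z$-axis, the first fundamental form has coefficients $E=\langle r_u,r_u\rangle$, $F=\langle r_u,r_v\rangle$, $G=\langle r_v,r_v\rangle$; put $W=EG-F^2$, assumed nonzero, and $\varepsilon=\operatorname{sgn}(W)$. The second fundamental form has coefficients $$L=\frac{\det(r_{uu},r_u,r_v)}{\sqrt{|W|}},\quad M=\frac{\det(r_{uv},r_u,r_v)}{\sqrt{|W|}},\quad N=\frac{\det(r_{vv},r_u,r_v)}{\sqrt{|W|}}.$$ The semi-isotropic mean curvature is $H=-\varepsilon\frac{EN-2FM+GL}{2W}$; for the surfaces of revolution $r(u,v)=(u\sinh v,\,u\cosh v,\,f(u))$ and $r(u,v)=(u\cosh v,\,u\sinh v,\,f(u))$ with $u>0$ one has $H=\frac12\left(\frac{f'}{u}+f''\right)$. Put $w=LN-M^2$. The surface has no parabolic points if $w\neq0$ everywhere; for the surfaces of revolution $r(u,v)=(u\sinh v,\,u\cosh v,\,f(u))$ and $r(u,v)=(u\cosh v,\,u\sinh v,\,f(u))$ with $u>0$ one has $w=-uf'f''$. When there are no parabolic points, the Laplace operator with respect to the second fundamental form is defined on smooth functions $\psi(u,v)$ by $$\bigtriangleup^{II}\psi=-\frac{1}{\sqrt{|w|}}\left\{\frac{\partial}{\partial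 u}\left(\frac{N\psi_u-M\psi_v}{\sqrt{|w|}}\right)-\frac{\partial}{\partial v}\left(\frac{M\psi_u-L\psi_v}{\sqrt{|w|}}\right)\right\}.$$ *)

theory Defs
  imports "HOL-Analysis.Analysis"
begin

definition si_inner :: "real^3 \<Rightarrow> real^3 \<Rightarrow> real" where
  "si_inner a b =
     (if a $ 1 = 0 \<and> a $ 2 = 0 \<and> b $ 1 = 0 \<and> b $ 2 = 0
      then a $ 3 * b $ 3
      else a $ 1 * b $ 1 - a $ 2 * b $ 2)"

(* Partial derivatives of g(u,v); used both for surfaces (values in real^3)
   and for scalar functions (values in real). *)

definition pd_u :: "(real \<Rightarrow> real \<Rightarrow> 'a::real_normed_vector) \<Rightarrow> real \<Rightarrow> real \<Rightarrow> 'a" where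
  "pd_u g u v = vector_derivative (\<lambda>s. g s v) (at u)"

definition pd_v :: "(real \<Rightarrow> real \<Rightarrow> 'a::real_normed_vector) \<Rightarrow> real \<Rightarrow> real \<Rightarrow> 'a" where
  "pd_v g u v = vector_derivative (\<lambda>t. g u t) (at v)"

type_synonym surface = "real \<Rightarrow> real \<Rightarrow> real^3"

definition ff_E :: "surface \<Rightarrow> real \<Rightarrow> real \<Rightarrow> real" where
  "ff_E r u v = si_inner (pd_u r u v) (pd_u r u v)"

definition ff_F :: "surface \<Rightarrow> real \<Rightarrow> real \<Rightarrow> real" where
  "ff_F r u v = si_inner (pd_u r u v) (pd_v r u v)"

definition ff_G :: "surface \<Rightarrow> real \<Rightarrow> real \<Rightarrow> real" where
  "ff_G r u v = si_inner (pd_v r u v) (pd_v r u v)"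

definition ff_W :: "surface \<Rightarrow> real \<Rightarrow> real \<Rightarrow> real" where
  "ff_W r u v = ff_E r u v * ff_G r u v - (ff_F r u v)\<^sup>2"

definition det3 :: "real^3 \<Rightarrow> real^3 \<Rightarrow> real^3 \<Rightarrow> real" where
  "det3 a b c = det (vector [a, b, c] :: real^3^3)"

definition sf_L :: "surface \<Rightarrow> real \<Rightarrow> real \<Rightarrow> real" where
  "sf_L r u v = det3 (pd_u (pd_u r) u v) (pd_u r u v) (pd_v r u v) / sqrt \<bar>ff_W r u v\<bar>"

definition sf_M :: "surface \<Rightarrow> real \<Rightarrow> real \<Rightarrow> real" where
  "sf_M r u v = det3 (pd_v (pd_u r) u v) (pd_u r u v) (pd_v r u v) / sqrt \<bar>ff_W r u v\<bar>"

definition sf_N :: "surface \<Rightarrow> real \<Rightarrow> real \<Rightarrow> real" where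
  "sf_N r u v = det3 (pd_v (pd_v r) u v) (pd_u r u v) (pd_v r u v) / sqrt \<bar>ff_W r u v\<bar>"

definition sf_w :: "surface \<Rightarrow> real \<Rightarrow> real \<Rightarrow> real" where
  "sf_w r u v = sf_L r u v * sf_N r u v - (sf_M r u v)\<^sup>2"

definition si_mean_curvature :: "surface \<Rightarrow> real \<Rightarrow> real \<Rightarrow> real" where
  "si_mean_curvature r u v =
     - sgn (ff_W r u v) *
       ((ff_E r u v * sf_N r u v - 2 * ff_F r u v * sf_M r u v + ff_G r u v * sf_L r u v) /
        (2 * ff_W r u v))"

definition si_minimal_on :: "real set \<Rightarrow> real set \<Rightarrow> surface \<Rightarrow> bool" where
  "si_minimal_on I J r \<longleftrightarrow> (\<forall>u\<in>I. \<forall>v\<in>J. si_mean_curvature r u v = 0)"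

definition no_parabolic_points_on :: "real set \<Rightarrow> real set \<Rightarrow> surface \<Rightarrow> bool" where
  "no_parabolic_points_on I J r \<longleftrightarrow> (\<forall>u\<in>I. \<forall>v\<in>J. sf_w r u v \<noteq> 0)"

definition laplace_II :: "surface \<Rightarrow> (real \<Rightarrow> real \<Rightarrow> real) \<Rightarrow> real \<Rightarrow> real \<Rightarrow> real" where
  "laplace_II r \<psi> u v =
     - (1 / sqrt \<bar>sf_w r u v\<bar>) *
       (pd_u (\<lambda>s t. (sf_N r s t * pd_u \<psi> s t - sf_M r s t * pd_v \<psi> s t) / sqrt \<bar>sf_w r s t\<bar>) u v
      - pd_v (\<lambda>s t. (sf_M r s t * pd_u \<psi> s t - sf_L r s t * pd_v \<psi> s t) / sqrt \<bar>sf_w r s t\<bar>) u v)"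

definition rev_surface_sc :: "(real \<Rightarrow> real) \<Rightarrow> surface" where
  "rev_surface_sc f u v = vector [u * sinh v, u * cosh v, f u]"

definition rev_surface_cs :: "(real \<Rightarrow> real) \<Rightarrow> surface" where
  "rev_surface_cs f u v = vector [u * cosh v, u * sinh v, f u]"

(* C-infinity; meant for open I, where the derivatives depend only on the values of f on I. *)

definition smooth_fun_on :: "real set \<Rightarrow> (real \<Rightarrow> real) \<Rightarrow> bool" where
  "smooth_fun_on I f \<longleftrightarrow> (\<forall>n. \<forall>x\<in>I. (deriv ^^ n) f differentiable (at x))"

end

theory Submission
  imports Defs
begin

text \<open>
  Both parametrizations have the form \<open>r(u,v) = (u p(v), u q(v), f(u))\<close> with \<open>p' = q\<close>, \<open>q' = p\<close> and
  \<open>q\<^sup>2 - p\<^sup>2 = \<sigma>\<close> for a sign \<open>\<sigma>\<close>. Such a surface has \<open>L = -\<sigma> f''\<close>, \<open>M = 0\<close>, \<open>N = \<sigma> u f'\<close>,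
  \<open>w = -u f' f''\<close> and \<open>H = (f'/u + f'')/2\<close>. Without parabolic points \<open>f' f''\<close> keeps a constant
  sign \<open>\<tau>\<close> on the interval, so the absolute value in the Laplace operator can be resolved once and
  for all. Since all three coordinates are products \<open>a(u) b(v)\<close>, one computation
  (\<open>laplace_II_separated\<close>) gives their Laplacians. The eigenvalue equations then become ordinary
  differential equations: up to the factor \<open>-\<sigma>\<tau>\<close> in the eigenvalues, the first two coordinates give
  (A) \<open>1/f'' - u/f' - u f'''/f''\<^sup>2 = 2 \<alpha> u\<^sup>2\<close>, and the third gives
  (B) \<open>f'/(u f'') + 3 - f' f'''/f''\<^sup>2 = 2 \<beta> f\<close>.

  The system can be decided without solving it (\<open>eigenvalue_equations_imp_minimal\<close>). Inserting (A)
  into (B) removes \<open>f'''\<close> and leaves \<open>\<alpha> u f' + 2 = \<beta> f\<close>. Here \<open>\<alpha> = 0\<close> would make \<open>f\<close> constant, so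
  differentiation gives \<open>u f'' = m f'\<close> with a constant \<open>m\<close>. Using this relation and its derivative in
  (A) shows that \<open>u f'\<close> is constant. Its derivative \<open>f' + u f''\<close> therefore vanishes, which is \<open>H = 0\<close>.
  Conversely, \<open>H = 0\<close> makes \<open>u f'\<close> a constant \<open>c\<close>, and then (A) and (B) hold with
  \<open>\<alpha> = -2/c\<close> and \<open>\<beta> = 0\<close>.
\<close>

section \<open>Calculus preliminaries\<close>

lemma vector_3_axis:
  "(vector [a, b, c] :: real^3) = a *\<^sub>R axis 1 1 + b *\<^sub>R axis 2 1 + c *\<^sub>R axis 3 1"
  by (simp add: vec_eq_iff forall_3 axis_def)

lemma has_vector_derivative_vector_3:
  assumes "(a has_real_derivative a') (at x)" "(b has_real_derivative b') (at x)"
    "(c has_real_derivative c') (at x)"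
  shows "((\<lambda>x. vector [a x, b x, c x] :: real^3) has_vector_derivative vector [a', b', c']) (at x)"
  unfolding vector_3_axis using assms
  by (auto intro!: derivative_eq_intros)

lemma pd_u_eqI:
  assumes "((\<lambda>s. g s v) has_vector_derivative D) (at u)"
  shows "pd_u g u v = D"
  using assms by (simp add: pd_u_def vector_derivative_at)

lemma pd_v_eqI:
  assumes "((\<lambda>t. g u t) has_vector_derivative D) (at v)"
  shows "pd_v g u v = D"
  using assms by (simp add: pd_v_def vector_derivative_at)

lemma pd_u_eqI_on_open:
  assumes "((\<lambda>s. h s v) has_vector_derivative D) (at u)"
    and "open I" "u \<in> I" "\<And>s. s \<in> I \<Longrightarrow> g s v = h s v"
  shows "pd_u g u v = D"
  by (rule pd_u_eqI, rule has_vector_derivative_transform_within_open[OF assms(1-3)])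
     (simp add: assms(4))

lemma nonvanishing_constant_sign:
  fixes g :: "'a::topological_space \<Rightarrow> real"
  assumes "connected S" "continuous_on S g" "\<And>x. x \<in> S \<Longrightarrow> g x \<noteq> 0"
  obtains \<tau> :: real where "\<tau> = 1 \<or> \<tau> = -1" "\<And>x. x \<in> S \<Longrightarrow> 0 < \<tau> * g x"
proof -
  have conn: "connected (g ` S)"
    using assms by (intro connected_continuous_image)
  have zero: "0 \<notin> g ` S"
    using assms(3) by force
  have same: "\<not> (g x < 0 \<and> 0 < g y)" if "x \<in> S" "y \<in> S" for x y
    using connectedD_interval[OF conn, of "g x" "g y" 0] zero that by auto
  show ?thesis
  proof (cases "\<forall>x\<in>S. 0 < g x")
    case True
    then show ?thesis by (intro that[of 1]) auto
  next
    case False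
    then obtain x where x: "x \<in> S" "g x < 0"
      using assms(3) by (meson linorder_neqE_linordered_idom)
    have "g y < 0" if "y \<in> S" for y
      using same[OF x(1) that] x(2) assms(3)[OF that] by auto
    then show ?thesis by (intro that[of "-1"]) auto
  qed
qed

text \<open>Dividing by the root of \<open>Y\<close> subtracts half of the logarithmic derivative of \<open>Y\<close>; the quotients
  under the derivative signs of the Laplace operator have this form.\<close>

lemma has_real_derivative_divide_sqrt:
  assumes "(X has_real_derivative X') (at u)" "(Y has_real_derivative Y') (at u)" "0 < Y u"
  shows "((\<lambda>s. X s / sqrt (Y s)) has_real_derivative (X' - X u * Y' / (2 * Y u)) / sqrt (Y u)) (at u)"
proof -
  define z where "z = sqrt (Y u)"
  have z: "0 < z" "Y u = z * z" using assms(3) by (auto simp: z_def)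
  have "((\<lambda>s. X s / sqrt (Y s)) has_real_derivative
      (X' * z - X u * (Y' * (inverse z / 2))) / (z * z)) (at u)"
    using assms z unfolding z_def
    by (auto intro!: derivative_eq_intros)
  moreover have "(X' * z - X u * (Y' * (inverse z / 2))) / (z * z) = (X' - X u * Y' / (2 * (z * z))) / z"
    using z(1) by (simp add: field_simps)
  ultimately show ?thesis unfolding z_def[symmetric] unfolding z(2) by simp
qed

lemma has_real_derivative_eq_on_open:
  assumes "open I" "u \<in> I" "\<And>s. s \<in> I \<Longrightarrow> g s = h s"
    "(g has_real_derivative D) (at u)" "(h has_real_derivative D') (at u)"
  shows "D = D'"
  using DERIV_unique[OF has_field_derivative_transform_within_open[OF assms(4,1,2,3)] assms(5)]
  by simp

section \<open>The differential equations of the profile curve\<close>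

text \<open>Eliminating \<open>f'''\<close> between the two equations gives a relation of first order. It and its
  consequences \<open>u f'' = m f'\<close> and \<open>u f' = const\<close> are free of \<open>f'''\<close> when they are differentiated, so
  three derivatives of \<open>f\<close> suffice.\<close>

lemma eigenvalue_equations_imp_minimal:
  fixes f f1 f2 f3 :: "real \<Rightarrow> real" and \<alpha> \<beta> :: real
  assumes I: "open I" "I \<subseteq> {0<..}"
    and f: "\<And>u. u \<in> I \<Longrightarrow> (f has_real_derivative f1 u) (at u)"
    and f1: "\<And>u. u \<in> I \<Longrightarrow> (f1 has_real_derivative f2 u) (at u)"
    and f2: "\<And>u. u \<in> I \<Longrightarrow> (f2 has_real_derivative f3 u) (at u)"
    and nz: "\<And>u. u \<in> I \<Longrightarrow> f1 u \<noteq> 0" "\<And>u. u \<in> I \<Longrightarrow> f2 u \<noteq> 0"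
    and A: "\<And>u. u \<in> I \<Longrightarrow> 1 / f2 u - u / f1 u - u * f3 u / (f2 u)\<^sup>2 = 2 * \<alpha> * u\<^sup>2"
    and B: "\<And>u. u \<in> I \<Longrightarrow> f1 u / (u * f2 u) + 3 - f1 u * f3 u / (f2 u)\<^sup>2 = 2 * \<beta> * f u"
    and u: "u \<in> I"
  shows "f1 u + u * f2 u = 0"
proof -
  have pos: "0 < s" if "s \<in> I" for s using I(2) that by auto
  have eq: "\<alpha> * (s * f1 s) + 2 = \<beta> * f s" if s: "s \<in> I" for s
  proof -
    have "f1 s / s * (1 / f2 s - s / f1 s - s * f3 s / (f2 s)\<^sup>2) + 4
        = f1 s / (s * f2 s) + 3 - f1 s * f3 s / (f2 s)\<^sup>2"
      using nz[OF s] pos[OF s] by (simp add: field_simps)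
    then have "f1 s / s * (2 * \<alpha> * s\<^sup>2) + 4 = 2 * \<beta> * f s"
      unfolding A[OF s] B[OF s] .
    then show ?thesis using pos[OF s] by (simp add: power2_eq_square field_simps)
  qed
  have deq: "\<alpha> * (f1 s + s * f2 s) = \<beta> * f1 s" if s: "s \<in> I" for s
  proof (rule has_real_derivative_eq_on_open[OF I(1) s eq])
    show "((\<lambda>s. \<alpha> * (s * f1 s) + 2) has_real_derivative \<alpha> * (f1 s + s * f2 s)) (at s)"
      by (auto intro!: derivative_eq_intros f1[OF s])
    show "((\<lambda>s. \<beta> * f s) has_real_derivative \<beta> * f1 s) (at s)"
      by (auto intro!: derivative_eq_intros f[OF s])
  qed
  have "\<alpha> \<noteq> 0"
  proof
    assume "\<alpha> = 0"
    then have "\<beta> = 0" using deq[OF u] nz(1)[OF u] by simp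
    then show False using eq[OF u] \<open>\<alpha> = 0\<close> by simp
  qed
  define m where "m = \<beta> / \<alpha> - 1"
  have m: "s * f2 s = m * f1 s" if s: "s \<in> I" for s
    using deq[OF s] \<open>\<alpha> \<noteq> 0\<close> by (simp add: m_def field_simps)
  have "m \<noteq> 0" using m[OF u] nz(2)[OF u] pos[OF u] by auto
  have dm: "f2 s + s * f3 s = m * f2 s" if s: "s \<in> I" for s
  proof (rule has_real_derivative_eq_on_open[OF I(1) s m])
    show "((\<lambda>s. s * f2 s) has_real_derivative f2 s + s * f3 s) (at s)"
      by (auto intro!: derivative_eq_intros f2[OF s])
    show "((\<lambda>s. m * f1 s) has_real_derivative m * f2 s) (at s)"
      by (auto intro!: derivative_eq_intros f1[OF s])
  qed
  have const: "s * f1 s = (1 - m) / (m * \<alpha>)" if s: "s \<in> I" for s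
  proof -
    have f2': "f2 s = m * f1 s / s" using m[OF s] pos[OF s] by (simp add: field_simps)
    have "s * f3 s / (f2 s)\<^sup>2 = (m - 1) / f2 s"
    proof -
      have "s * f3 s = (m - 1) * f2 s" using dm[OF s] by (simp add: algebra_simps)
      then show ?thesis using nz(2)[OF s] by (simp add: power2_eq_square)
    qed
    then have "(1 - (m - 1)) / f2 s - s / f1 s = 2 * \<alpha> * s\<^sup>2"
      using A[OF s] by (simp add: diff_divide_distrib)
    then have "f1 s * ((2 - 2 * m) * s) = f1 s * (2 * \<alpha> * s\<^sup>2 * m * f1 s)"
      unfolding f2' using nz(1)[OF s] \<open>m \<noteq> 0\<close> pos[OF s]
      by (simp add: field_simps power2_eq_square)
    then have "(2 - 2 * m) * s = 2 * \<alpha> * s\<^sup>2 * m * f1 s"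
      using nz(1)[OF s] by simp
    then have "s * (1 - m) = s * (\<alpha> * s * m * f1 s)"
      by (simp add: power2_eq_square algebra_simps)
    then have "1 - m = \<alpha> * s * m * f1 s" using pos[OF s] by simp
    then show ?thesis using \<open>m \<noteq> 0\<close> \<open>\<alpha> \<noteq> 0\<close> by (simp add: field_simps)
  qed
  show ?thesis
  proof (rule has_real_derivative_eq_on_open[OF I(1) u const])
    show "((\<lambda>s. s * f1 s) has_real_derivative f1 u + u * f2 u) (at u)"
      by (auto intro!: derivative_eq_intros f1[OF u])
  qed auto
qed

section \<open>Surfaces of revolution over a hyperbolic pair\<close>

text \<open>The pair \<open>(p, q)\<close> is \<open>(sinh, cosh)\<close> with \<open>\<sigma> = 1\<close> or \<open>(cosh, sinh)\<close> with \<open>\<sigma> = -1\<close>, so that both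
  kinds of surfaces of revolution are treated at once.\<close>

locale hyperbolic_revolution =
  fixes I :: "real set" and f f1 f2 f3 p q :: "real \<Rightarrow> real" and \<sigma> :: real and r :: surface
  assumes open_I: "open I" and I_pos: "I \<subseteq> {0<..}"
    and f: "\<And>u. u \<in> I \<Longrightarrow> (f has_real_derivative f1 u) (at u)"
    and f1: "\<And>u. u \<in> I \<Longrightarrow> (f1 has_real_derivative f2 u) (at u)"
    and f2: "\<And>u. u \<in> I \<Longrightarrow> (f2 has_real_derivative f3 u) (at u)"
    and p: "\<And>v. (p has_real_derivative q v) (at v)"
    and q: "\<And>v. (q has_real_derivative p v) (at v)"
    and pq: "\<And>v. (q v)\<^sup>2 - (p v)\<^sup>2 = \<sigma>"
    and sigma: "\<sigma> = 1 \<or> \<sigma> = -1"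
    and r: "\<And>u v. r u v = vector [u * p v, u * q v, f u]"
begin

lemma pos: "u \<in> I \<Longrightarrow> 0 < u"
  using I_pos by auto

lemma pq_nonzero: "p v \<noteq> 0 \<or> q v \<noteq> 0"
  using pq[of v] sigma by auto

lemma r_u: "u \<in> I \<Longrightarrow> pd_u r u v = vector [p v, q v, f1 u]"
  by (rule pd_u_eqI, unfold r, rule has_vector_derivative_vector_3)
     (auto intro!: derivative_eq_intros f)

lemma r_v: "pd_v r u v = vector [u * q v, u * p v, 0]"
  by (rule pd_v_eqI, unfold r, rule has_vector_derivative_vector_3)
     (auto intro!: derivative_eq_intros p q)

lemma r_uu: "u \<in> I \<Longrightarrow> pd_u (pd_u r) u v = vector [0, 0, f2 u]"
  by (rule pd_u_eqI_on_open[where h = "\<lambda>s t. vector [p t, q t, f1 s]",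
        OF has_vector_derivative_vector_3 open_I _ r_u])
     (auto intro!: derivative_eq_intros f1)

lemma r_uv: "u \<in> I \<Longrightarrow> pd_v (pd_u r) u v = vector [q v, p v, 0]"
  by (rule pd_v_eqI, simp only: r_u, rule has_vector_derivative_vector_3)
     (auto intro!: derivative_eq_intros p q)

lemma r_vv: "pd_v (pd_v r) u v = vector [u * p v, u * q v, 0]"
  by (rule pd_v_eqI, simp only: r_v, rule has_vector_derivative_vector_3)
     (auto intro!: derivative_eq_intros p q)

lemma E: "u \<in> I \<Longrightarrow> ff_E r u v = - \<sigma>"
  using pq[of v] pq_nonzero[of v] by (auto simp: ff_E_def si_inner_def r_u power2_eq_square)

lemma F: "u \<in> I \<Longrightarrow> ff_F r u v = 0"
  using pq_nonzero[of v] by (auto simp: ff_F_def si_inner_def r_u r_v)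

lemma G: "u \<in> I \<Longrightarrow> ff_G r u v = \<sigma> * u\<^sup>2"
  using pq_nonzero[of v] pos[of u]
  by (auto simp: ff_G_def si_inner_def r_v pq[of v, symmetric] power2_eq_square algebra_simps)

lemma W: "u \<in> I \<Longrightarrow> ff_W r u v = - u\<^sup>2"
  using sigma by (auto simp: ff_W_def E F G)

lemma sqrt_W: "u \<in> I \<Longrightarrow> sqrt \<bar>ff_W r u v\<bar> = u"
  using pos[of u] by (simp add: W)

lemma L: "u \<in> I \<Longrightarrow> sf_L r u v = - \<sigma> * f2 u"
  using pos[of u]
  by (simp add: sf_L_def sqrt_W r_uu r_u r_v det3_def det_3 pq[of v, symmetric]
      field_simps power2_eq_square)

lemma M: "u \<in> I \<Longrightarrow> sf_M r u v = 0"
  by (simp add: sf_M_def r_uv r_u r_v det3_def det_3)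

lemma N: "u \<in> I \<Longrightarrow> sf_N r u v = \<sigma> * (u * f1 u)"
  using pos[of u]
  by (simp add: sf_N_def sqrt_W r_vv r_u r_v det3_def det_3 pq[of v, symmetric]
      field_simps power2_eq_square)

lemma w: "u \<in> I \<Longrightarrow> sf_w r u v = - (u * f1 u * f2 u)"
  using sigma by (auto simp: sf_w_def L M N)

lemma mean_curvature: "u \<in> I \<Longrightarrow> si_mean_curvature r u v = (f1 u / u + f2 u) / 2"
  using pos[of u] sigma
  by (auto simp: si_mean_curvature_def E F G W L M N field_simps power2_eq_square)

lemma minimal_iff: "si_minimal_on I UNIV r \<longleftrightarrow> (\<forall>u\<in>I. f1 u + u * f2 u = 0)"
proof -
  have "(f1 u / u + f2 u) / 2 = 0 \<longleftrightarrow> f1 u + u * f2 u = 0" if "u \<in> I" for u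
    using pos[OF that] by (simp add: field_simps)
  then show ?thesis by (simp add: si_minimal_on_def mean_curvature)
qed

text \<open>On functions \<open>a(u) b(v)\<close> the Laplace operator separates because \<open>M = 0\<close> and \<open>L\<close>, \<open>N\<close>, \<open>w\<close> depend
  on \<open>u\<close> only. The constant sign \<open>\<tau>\<close> of \<open>f' f''\<close> replaces \<open>\<bar>w\<bar>\<close> by the smooth function
  \<open>\<tau> u f' f''\<close>, whose logarithmic derivative is \<open>1/u + f''/f' + f'''/f''\<close>.\<close>

lemma laplace_II_separated:
  assumes tau: "\<tau> = 1 \<or> \<tau> = -1" "\<And>s. s \<in> I \<Longrightarrow> 0 < \<tau> * (f1 s * f2 s)"
    and a: "\<And>s. s \<in> I \<Longrightarrow> (a has_real_derivative a1 s) (at s)"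
    and a1: "\<And>s. s \<in> I \<Longrightarrow> (a1 has_real_derivative a2 s) (at s)"
    and b: "\<And>t. (b has_real_derivative b1 t) (at t)"
    and b1: "\<And>t. (b1 has_real_derivative b2 t) (at t)"
    and u: "u \<in> I"
  shows "laplace_II r (\<lambda>s t. a s * b t) u v =
    - (\<sigma> * \<tau> / (u * f1 u * f2 u)) *
      ((f1 u * a1 u / 2 + u * f2 u * a1 u / 2 + u * f1 u * a2 u - u * f1 u * a1 u * f3 u / (2 * f2 u)) * b v
        - f2 u * a u * b2 v)"
proof -
  define Y where "Y = (\<lambda>s. \<tau> * (s * (f1 s * f2 s)))"
  have nz: "f1 u \<noteq> 0" "f2 u \<noteq> 0" "0 < u" using tau(2)[OF u] pos[OF u] by auto
  have Y: "0 < Y s" if "s \<in> I" for s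
    using mult_pos_pos[OF pos[OF that] tau(2)[OF that]] by (simp add: Y_def mult_ac)
  have abs_w: "\<bar>sf_w r s t\<bar> = Y s" if "s \<in> I" for s t
    using Y[OF that] tau(1) by (auto simp: w[OF that] Y_def abs_if mult.assoc)
  have Y': "(Y has_real_derivative Y u * (1 / u + f2 u / f1 u + f3 u / f2 u)) (at u)"
    unfolding Y_def using nz
    by (auto intro!: derivative_eq_intros f1[OF u] f2[OF u] simp: field_simps)
  have psi_u: "pd_u (\<lambda>s t. a s * b t) s t = a1 s * b t" if "s \<in> I" for s t
    by (rule pd_u_eqI)
       (auto intro!: derivative_eq_intros a[OF that]
         simp flip: has_real_derivative_iff_has_vector_derivative)
  have psi_v: "pd_v (\<lambda>s t. a s * b t) s t = a s * b1 t" for s t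
    by (rule pd_v_eqI)
       (auto intro!: derivative_eq_intros b
         simp flip: has_real_derivative_iff_has_vector_derivative)
  define X where "X = (\<lambda>s. \<sigma> * (s * f1 s * a1 s * b v))"
  define X' where "X' = \<sigma> * ((f1 u * a1 u + u * f2 u * a1 u + u * f1 u * a2 u) * b v)"
  have X': "(X has_real_derivative X') (at u)"
    unfolding X_def X'_def using nz
    by (auto intro!: derivative_eq_intros f1[OF u] a1[OF u] simp: algebra_simps)
  define Q where "Q = X u * (1 / u + f2 u / f1 u + f3 u / f2 u) / 2"
  have "((\<lambda>s. X s / sqrt (Y s)) has_real_derivative (X' - Q) / sqrt (Y u)) (at u)"
    using has_real_derivative_divide_sqrt[OF X' Y' Y[OF u]] Y[OF u]
    by (simp add: Q_def)
  then have du: "pd_u (\<lambda>s t. (sf_N r s t * pd_u (\<lambda>s t. a s * b t) s t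
        - sf_M r s t * pd_v (\<lambda>s t. a s * b t) s t) / sqrt \<bar>sf_w r s t\<bar>) u v
      = (X' - Q) / sqrt (Y u)"
    by (intro pd_u_eqI_on_open[OF _ open_I u])
       (auto simp: abs_w M N psi_u X_def has_real_derivative_iff_has_vector_derivative mult.assoc)
  have "((\<lambda>t. \<sigma> * f2 u * (a u * b1 t) / sqrt (Y u)) has_real_derivative
      \<sigma> * f2 u * (a u * b2 v) / sqrt (Y u)) (at v)"
    by (intro DERIV_cdivide DERIV_cmult b1)
  then have dv: "pd_v (\<lambda>s t. (sf_M r s t * pd_u (\<lambda>s t. a s * b t) s t
        - sf_L r s t * pd_v (\<lambda>s t. a s * b t) s t) / sqrt \<bar>sf_w r s t\<bar>) u v
      = \<sigma> * f2 u * (a u * b2 v) / sqrt (Y u)"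
    by (intro pd_v_eqI)
       (simp add: abs_w u M L psi_v has_real_derivative_iff_has_vector_derivative)
  have inverse_Y: "1 / Y u = \<tau> / (u * f1 u * f2 u)"
    using tau(1) by (auto simp: Y_def mult.assoc)
  have "laplace_II r (\<lambda>s t. a s * b t) u v
      = - ((X' - Q - \<sigma> * f2 u * (a u * b2 v)) / (sqrt (Y u) * sqrt (Y u)))"
    unfolding laplace_II_def du dv abs_w[OF u] by (simp add: diff_divide_distrib add_divide_distrib algebra_simps)
  also have "sqrt (Y u) * sqrt (Y u) = Y u" using Y[OF u] by simp
  also have "- ((X' - Q - \<sigma> * f2 u * (a u * b2 v)) / Y u)
      = - (\<tau> / (u * f1 u * f2 u)) * (X' - Q - \<sigma> * f2 u * (a u * b2 v))"
    unfolding inverse_Y[symmetric] by simp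
  also have "X' - Q - \<sigma> * f2 u * (a u * b2 v) = \<sigma> *
      ((f1 u * a1 u / 2 + u * f2 u * a1 u / 2 + u * f1 u * a2 u - u * f1 u * a1 u * f3 u / (2 * f2 u)) * b v
        - f2 u * a u * b2 v)"
    unfolding X'_def Q_def X_def using nz by (simp add: field_simps)
  finally show ?thesis by (simp add: mult_ac)
qed

text \<open>A solution of \<open>b'' = b\<close> covers the first two coordinates, as \<open>p'' = p\<close> and \<open>q'' = q\<close>.\<close>

lemma laplace_II_horizontal:
  assumes tau: "\<tau> = 1 \<or> \<tau> = -1" "\<And>s. s \<in> I \<Longrightarrow> 0 < \<tau> * (f1 s * f2 s)"
    and b: "\<And>t. (b has_real_derivative b1 t) (at t)" "\<And>t. (b1 has_real_derivative b t) (at t)"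
    and u: "u \<in> I"
  shows "laplace_II r (\<lambda>s t. s * b t) u v =
    - (\<sigma> * \<tau> / 2) * (1 / f2 u - u / f1 u - u * f3 u / (f2 u)\<^sup>2) / u * b v"
proof -
  have nz: "f1 u \<noteq> 0" "f2 u \<noteq> 0" "0 < u" using tau(2)[OF u] pos[OF u] by auto
  show ?thesis
    using nz
    by (subst laplace_II_separated[where ?a1.0 = "\<lambda>_. 1" and ?a2.0 = "\<lambda>_. 0", OF tau _ _ b u])
       (auto intro!: derivative_eq_intros simp: field_simps power2_eq_square)
qed

lemma laplace_II_height:
  assumes tau: "\<tau> = 1 \<or> \<tau> = -1" "\<And>s. s \<in> I \<Longrightarrow> 0 < \<tau> * (f1 s * f2 s)"
    and u: "u \<in> I"
  shows "laplace_II r (\<lambda>s t. f s) u v =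
    - (\<sigma> * \<tau> / 2) * (f1 u / (u * f2 u) + 3 - f1 u * f3 u / (f2 u)\<^sup>2)"
proof -
  have nz: "f1 u \<noteq> 0" "f2 u \<noteq> 0" "0 < u" using tau(2)[OF u] pos[OF u] by auto
  have "laplace_II r (\<lambda>s t. f s * 1) u v =
    - (\<sigma> * \<tau> / 2) * (f1 u / (u * f2 u) + 3 - f1 u * f3 u / (f2 u)\<^sup>2)"
    using nz
    by (subst laplace_II_separated[where ?b1.0 = "\<lambda>_. 0" and ?b2.0 = "\<lambda>_. 0", OF tau f f1 _ _ u])
       (auto simp: field_simps power2_eq_square)
  then show ?thesis by simp
qed

theorem coordinates_eigenfunctions_iff_minimal:
  assumes "is_interval I" "I \<noteq> {}" "no_parabolic_points_on I UNIV r"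
  shows "(\<exists>l1 l2 l3 :: real. \<forall>u\<in>I. \<forall>v.
            laplace_II r (\<lambda>s t. r s t $ 1) u v = l1 * r u v $ 1 \<and>
            laplace_II r (\<lambda>s t. r s t $ 2) u v = l2 * r u v $ 2 \<and>
            laplace_II r (\<lambda>s t. r s t $ 3) u v = l3 * r u v $ 3)
         \<longleftrightarrow> si_minimal_on I UNIV r"
    (is "?eigen \<longleftrightarrow> _")
proof -
  have nz: "f1 u \<noteq> 0" "f2 u \<noteq> 0" if "u \<in> I" for u
    using assms(3) that by (auto simp: no_parabolic_points_on_def w)
  have "continuous_on I (\<lambda>u. f1 u * f2 u)"
    by (intro continuous_at_imp_continuous_on ballI continuous_intros)
       (blast intro: DERIV_isCont f1 f2)+
  then obtain \<tau> where tau: "\<tau> = 1 \<or> \<tau> = -1" "\<And>s. s \<in> I \<Longrightarrow> 0 < \<tau> * (f1 s * f2 s)"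
    using nonvanishing_constant_sign[of I "\<lambda>u. f1 u * f2 u"] is_interval_connected[OF assms(1)] nz
    by auto
  define A where "A = (\<lambda>u. 1 / f2 u - u / f1 u - u * f3 u / (f2 u)\<^sup>2)"
  define B where "B = (\<lambda>u. f1 u / (u * f2 u) + 3 - f1 u * f3 u / (f2 u)\<^sup>2)"
  have delta: "laplace_II r (\<lambda>s t. r s t $ 1) u v = - (\<sigma> * \<tau> / 2) * A u / u * p v"
    "laplace_II r (\<lambda>s t. r s t $ 2) u v = - (\<sigma> * \<tau> / 2) * A u / u * q v"
    "laplace_II r (\<lambda>s t. r s t $ 3) u v = - (\<sigma> * \<tau> / 2) * B u" if "u \<in> I" for u v
    using laplace_II_horizontal[OF tau p q that] laplace_II_horizontal[OF tau q p that]
      laplace_II_height[OF tau that]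
    by (simp_all add: r A_def B_def)
  show ?thesis
  proof
    assume ?eigen
    then obtain l1 l2 l3 where "\<forall>u\<in>I. \<forall>v.
        laplace_II r (\<lambda>s t. r s t $ 1) u v = l1 * r u v $ 1 \<and>
        laplace_II r (\<lambda>s t. r s t $ 2) u v = l2 * r u v $ 2 \<and>
        laplace_II r (\<lambda>s t. r s t $ 3) u v = l3 * r u v $ 3"
      by blast
    then have l: "- (\<sigma> * \<tau> / 2) * A u / u * p v = l1 * r u v $ 1"
      "- (\<sigma> * \<tau> / 2) * A u / u * q v = l2 * r u v $ 2"
      "- (\<sigma> * \<tau> / 2) * B u = l3 * r u v $ 3" if "u \<in> I" for u v
      using delta[OF that, of v] that by auto
    note l = l[unfolded r vector_3]
    \<comment> \<open>One of \<open>p\<close> and \<open>q\<close> is nonzero at \<open>v = 0\<close>, and the equation of the corresponding coordinate can be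
      divided by that value.\<close>
    obtain l where la: "\<And>u. u \<in> I \<Longrightarrow> - (\<sigma> * \<tau> / 2) * A u / u = l * u"
    proof (cases "p 0 = 0")
      case True
      then have "q 0 \<noteq> 0" using pq_nonzero[of 0] by auto
      have "- (\<sigma> * \<tau> / 2) * A u / u = l2 * u" if "u \<in> I" for u
        using l(2)[OF that, of 0] \<open>q 0 \<noteq> 0\<close>
        unfolding mult.assoc[of l2, symmetric] mult_right_cancel[OF \<open>q 0 \<noteq> 0\<close>] by blast
      then show ?thesis by (rule that)
    next
      case False
      have "- (\<sigma> * \<tau> / 2) * A u / u = l1 * u" if "u \<in> I" for u
        using l(1)[OF that, of 0] \<open>p 0 \<noteq> 0\<close>
        unfolding mult.assoc[of l1, symmetric] mult_right_cancel[OF \<open>p 0 \<noteq> 0\<close>] by blast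
      then show ?thesis by (rule that)
    qed
    have A: "A u = 2 * (- (\<sigma> * \<tau>) * l) * u\<^sup>2" if "u \<in> I" for u
      using la[OF that] pos[OF that] sigma tau(1)
      by (auto simp: field_simps power2_eq_square)
    have B: "B u = 2 * (- (\<sigma> * \<tau>) * l3) * f u" if "u \<in> I" for u
      using l(3)[OF that] sigma tau(1) by auto
    have "f1 u + u * f2 u = 0" if "u \<in> I" for u
      by (rule eigenvalue_equations_imp_minimal[OF open_I I_pos f f1 f2 nz
            A[unfolded A_def] B[unfolded B_def] that])
    then show "si_minimal_on I UNIV r" by (simp add: minimal_iff)
  next
    assume "si_minimal_on I UNIV r"
    then have min: "u * f2 u = - f1 u" if "u \<in> I" for u
      using that minimal_iff by fastforce
    have "\<exists>c. \<forall>u\<in>I. u * f1 u = c"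
    proof (rule has_field_derivative_zero_constant)
      show "convex I" using assms(1) by (simp add: is_interval_convex)
      show "((\<lambda>u. u * f1 u) has_field_derivative 0) (at u within I)" if "u \<in> I" for u
      proof (rule has_field_derivative_at_within)
        have "((\<lambda>u. u * f1 u) has_real_derivative f1 u + u * f2 u) (at u)"
          by (auto intro!: derivative_eq_intros f1[OF that])
        then show "((\<lambda>u. u * f1 u) has_real_derivative 0) (at u)"
          using min[OF that] by simp
      qed
    qed
    then obtain c where c: "\<And>u. u \<in> I \<Longrightarrow> u * f1 u = c" by auto
    have c0: "c \<noteq> 0" using assms(2) c nz pos by fastforce
    have f3': "f2 u + u * f3 u = - f2 u" if u: "u \<in> I" for u
    proof (rule has_real_derivative_eq_on_open[OF open_I u min])
      show "((\<lambda>u. u * f2 u) has_real_derivative f2 u + u * f3 u) (at u)"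
        by (auto intro!: derivative_eq_intros f2[OF u])
      show "((\<lambda>u. - f1 u) has_real_derivative - f2 u) (at u)"
        by (auto intro!: derivative_eq_intros f1[OF u])
    qed
    have profile: "f1 u = c / u" "f2 u = - c / u\<^sup>2" "f3 u = 2 * c / u ^ 3" if u: "u \<in> I" for u
    proof -
      show *: "f1 u = c / u" using c[OF u] pos[OF u] by (simp add: field_simps)
      show **: "f2 u = - c / u\<^sup>2"
        using min[OF u] pos[OF u] unfolding * by (simp add: field_simps power2_eq_square)
      show "f3 u = 2 * c / u ^ 3"
        using f3'[OF u] pos[OF u] unfolding **
        by (simp add: field_simps power2_eq_square power3_eq_cube)
    qed
    have A: "A u = - 4 * u\<^sup>2 / c" and B: "B u = 0" if "u \<in> I" for u
      using pos[OF that] c0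
      by (simp_all add: A_def B_def profile[OF that] field_simps power2_eq_square power3_eq_cube)
    \<comment> \<open>The horizontal eigenvalue is \<open>-\<sigma>\<tau>\<alpha>\<close> for the constant \<open>\<alpha> = -2/c\<close> read off from \<open>A\<close>.\<close>
    show ?eigen
    proof (rule exI[of _ "2 * \<sigma> * \<tau> / c"], rule exI[of _ "2 * \<sigma> * \<tau> / c"],
        rule exI[of _ 0], intro ballI allI conjI)
      fix u v assume u: "u \<in> I"
      show "laplace_II r (\<lambda>s t. r s t $ 1) u v = 2 * \<sigma> * \<tau> / c * r u v $ 1"
        "laplace_II r (\<lambda>s t. r s t $ 2) u v = 2 * \<sigma> * \<tau> / c * r u v $ 2"
        "laplace_II r (\<lambda>s t. r s t $ 3) u v = 0 * r u v $ 3"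
        unfolding delta[OF u] A[OF u] B[OF u] using pos[OF u] c0
        by (simp_all add: r field_simps power2_eq_square)
    qed
  qed
qed

end

section \<open>The two families of surfaces of revolution\<close>

theorem corollary4p1:
  fixes I :: "real set" and f :: "real \<Rightarrow> real" and r :: surface
  assumes "open I" and "is_interval I" and "I \<noteq> {}" and "I \<subseteq> {0<..}"
    and "smooth_fun_on I f"
    and "r = rev_surface_sc f \<or> r = rev_surface_cs f"
    and "no_parabolic_points_on I UNIV r"
  shows "(\<exists>l1 l2 l3 :: real. \<forall>u\<in>I. \<forall>v.
            laplace_II r (\<lambda>s t. r s t $ 1) u v = l1 * r u v $ 1 \<and>
            laplace_II r (\<lambda>s t. r s t $ 2) u v = l2 * r u v $ 2 \<and>
            laplace_II r (\<lambda>s t. r s t $ 3) u v = l3 * r u v $ 3)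
         \<longleftrightarrow> si_minimal_on I UNIV r"
proof -
  have D: "((deriv ^^ n) f has_real_derivative (deriv ^^ Suc n) f u) (at u)" if "u \<in> I" for n u
    using assms(5) that by (auto simp: smooth_fun_on_def DERIV_deriv_iff_real_differentiable)
  note D3 = D[where n = 0, simplified] D[where n = 1, simplified] D[where n = "Suc 1", simplified]
  show ?thesis
    using assms(6)
  proof
    assume "r = rev_surface_sc f"
    then interpret hyperbolic_revolution I f "deriv f" "deriv (deriv f)" "deriv (deriv (deriv f))"
      sinh cosh 1 r
      using assms(1,4) D3
      by unfold_locales
         (auto simp: rev_surface_sc_def cosh_square_eq intro!: derivative_eq_intros)
    show ?thesis by (rule coordinates_eigenfunctions_iff_minimal[OF assms(2,3,7)])
  next
    assume "r = rev_surface_cs f"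
    then interpret hyperbolic_revolution I f "deriv f" "deriv (deriv f)" "deriv (deriv (deriv f))"
      cosh sinh "-1" r
      using assms(1,4) D3
      by unfold_locales
         (auto simp: rev_surface_cs_def cosh_square_eq intro!: derivative_eq_intros)
    show ?thesis by (rule coordinates_eigenfunctions_iff_minimal[OF assms(2,3,7)])
  qed
qed

end
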